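(* Let $X$ be a Banach space. The following assertions are equivalent. (1) There is a topology $\tau$ on $X^*$ such that $\text{(I)-env}(A)=\overline{\operatorname{conv} A}^{\tau}$ for each $A\subset X^*$. (2) If $A_1,\dots,A_n$ are convex subsets of $X^*$ such that $A_1\cup\dots\cup A_n$ is also convex, then $$\text{(I)-env}(A_1\cup\dots\cup A_n)=\text{(I)-env}(A_1)\cup\dots\cup\text{(I)-env}(A_n).$$ (3) $\text{(I)-env}(A)=\operatorname{cl}_{IF}(\operatorname{conv} A)$ for each $A\subset X^*$.
   Context: Banach spaces are real or complex. For a Banach space $X$ and $A\subset X^*$, the (I)-envelope of $A$ is $$\text{(I)-env}(A)= \bigcap\left\{\overline{\operatorname{conv}\bigcup_{n=1}^\infty \overline{\operatorname{conv} A_n}^{w^*}}^{\|\cdot\|} : A=\bigcup_{n=1}^\infty A_n\right\},$$ the intersection being over all countable covers $A=\bigcup_n A_n$ by subsets of $A$. Here $\operatorname{conv}$ is the convex hull. Further, $$\operatorname{cl}_{IF}(A)=\bigcap\left\{\bigcup_{j=1}^n \text{(I)-env}(A_j) : A=\bigcup_{j=1}^n A_j,\ n\in\mathbb{N}\right\}.$$ $\overline{A}^{\tau}$ denotes the closure of $A$ in the topology $\tau$. In (1), $\tau$ is an arbitrary topology on the set $X^*$ (no compatibility with the linear structure is assumed). *)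

theory Defs
  imports "HOL-Analysis.Analysis"
begin

text \<open>
  A Banach space over the scalar field \<open>'k\<close> (used for \<open>real\<close> and \<open>complex\<close>). The library class
  \<open>banach\<close> only provides the real structure; \<open>smul\<close> is a scalar multiplication extending it and
  compatible with the norm. For \<open>'k = real\<close> the only possibility is \<open>smul = scaleR\<close>.
\<close>

locale banach_space_over = vector_space smul
  for smul :: "'k::real_normed_field \<Rightarrow> 'a::banach \<Rightarrow> 'a" +
  assumes smul_of_real: "smul (of_real r) x = r *\<^sub>R x"
    and norm_smul: "norm (smul c x) = norm c * norm x"

lemma banach_space_over_scaleR:
  "banach_space_over ((*\<^sub>R) :: real \<Rightarrow> 'a::banach \<Rightarrow> 'a)"
  by unfold_locales (auto simp: algebra_simps)

definition continuous_dual ::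
    "('k::real_normed_field \<Rightarrow> 'a::banach \<Rightarrow> 'a) \<Rightarrow> ('a \<Rightarrow>\<^sub>L 'k) set"
  where "continuous_dual smul =
    {f. \<forall>c x. blinfun_apply f (smul c x) = c * blinfun_apply f x}"

lemma continuous_dual_scaleR:
  "continuous_dual ((*\<^sub>R) :: real \<Rightarrow> 'a::banach \<Rightarrow> 'a) = UNIV"
  by (auto simp: continuous_dual_def blinfun.scaleR_right)

text \<open>
  For scalar-valued operators the strong operator topology is the topology of pointwise convergence
  on the space, which on the dual is the weak* topology.
\<close>

definition weak_star ::
    "('k::real_normed_field \<Rightarrow> 'a::banach \<Rightarrow> 'a) \<Rightarrow> ('a \<Rightarrow>\<^sub>L 'k) topology"
  where "weak_star smul = subtopology strong_operator_topology (continuous_dual smul)"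

text \<open>
  The library's \<open>closure\<close> is taken in the type \<open>'a \<Rightarrow>\<^sub>L 'k\<close> with its operator norm. This is the norm
  closure in the dual, since \<open>continuous_dual smul\<close> is norm closed. Convexity and convex hulls are
  with respect to real coefficients, also over the complex field.
\<close>

definition I_env ::
    "('k::real_normed_field \<Rightarrow> 'a::banach \<Rightarrow> 'a) \<Rightarrow> ('a \<Rightarrow>\<^sub>L 'k) set \<Rightarrow> ('a \<Rightarrow>\<^sub>L 'k) set"
  where "I_env smul A =
    \<Inter> {closure (convex hull (\<Union>n. weak_star smul closure_of (convex hull (B n)))) |
        B :: nat \<Rightarrow> ('a \<Rightarrow>\<^sub>L 'k) set. A = (\<Union>n. B n)}"

definition cl_IF ::
    "('k::real_normed_field \<Rightarrow> 'a::banach \<Rightarrow> 'a) \<Rightarrow> ('a \<Rightarrow>\<^sub>L 'k) set \<Rightarrow> ('a \<Rightarrow>\<^sub>L 'k) set"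
  where "cl_IF smul A =
    \<Inter> {\<Union>j\<in>{1..n}. I_env smul (B j) |
        (n :: nat) (B :: nat \<Rightarrow> ('a \<Rightarrow>\<^sub>L 'k) set). 1 \<le> n \<and> A = (\<Union>j\<in>{1..n}. B j)}"

text \<open>
  The topology need not be compatible with the linear structure; its carrier is the dual.
\<close>

definition I_env_is_topological_closure ::
    "('k::real_normed_field \<Rightarrow> 'a::banach \<Rightarrow> 'a) \<Rightarrow> bool"
  where "I_env_is_topological_closure smul \<longleftrightarrow>
    (\<exists>\<tau> :: ('a \<Rightarrow>\<^sub>L 'k) topology.
        topspace \<tau> = continuous_dual smul \<and>
        (\<forall>A \<subseteq> continuous_dual smul. I_env smul A = \<tau> closure_of (convex hull A)))"

definition I_env_preserves_convex_finite_unions ::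
    "('k::real_normed_field \<Rightarrow> 'a::banach \<Rightarrow> 'a) \<Rightarrow> bool"
  where "I_env_preserves_convex_finite_unions smul \<longleftrightarrow>
    (\<forall>(n :: nat) (A :: nat \<Rightarrow> ('a \<Rightarrow>\<^sub>L 'k) set).
        1 \<le> n \<and> (\<forall>j\<in>{1..n}. A j \<subseteq> continuous_dual smul \<and> convex (A j)) \<and>
        convex (\<Union>j\<in>{1..n}. A j) \<longrightarrow>
        I_env smul (\<Union>j\<in>{1..n}. A j) = (\<Union>j\<in>{1..n}. I_env smul (A j)))"

definition I_env_eq_cl_IF_convex_hull ::
    "('k::real_normed_field \<Rightarrow> 'a::banach \<Rightarrow> 'a) \<Rightarrow> bool"
  where "I_env_eq_cl_IF_convex_hull smul \<longleftrightarrow>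
    (\<forall>A \<subseteq> continuous_dual smul. I_env smul A = cl_IF smul (convex hull A))"

end

theory Submission
  imports Defs
begin

text \<open>
  The proof rests on three facts about the envelope on subsets of the dual: it is monotone, it does
  not change when a set is replaced by its convex hull, and it is idempotent with convex values. Once
  they are known, the equivalence is formal.

  A topological closure commutes with finite unions, and a convex set is its own hull, so an envelope
  that is a topological closure of hulls preserves convex finite unions. If it preserves them and
  \<open>B\<^sub>1, \<dots>, B\<^sub>n\<close> cover \<open>conv A\<close>, then the convex sets \<open>conv B\<^sub>j\<close> still have union \<open>conv A\<close>, so the
  envelope of \<open>A\<close> is the union of the envelopes of the \<open>B\<^sub>j\<close>; hence it equals \<open>cl_IF (conv A)\<close>. Suppose
  finally that this equality holds for all \<open>A\<close>, and take as closed sets of \<open>\<tau>\<close> the sets \<open>F\<close> with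
  \<open>cl_IF F \<subseteq> F\<close>. They form a topology because \<open>cl_IF\<close> is monotone and \<open>cl_IF (A \<union> B)\<close> lies in
  \<open>cl_IF A \<union> cl_IF B\<close>. The delicate point is that \<open>cl_IF (conv A)\<close>, which is \<open>I_env A\<close>, is closed. As
  \<open>I_env A\<close> is convex, the assumed equality turns its \<open>cl_IF\<close> into its envelope, and the envelope is
  idempotent.

  The three facts come from one description of the envelope (\<open>I_env_eq_exhaustions\<close>): instead of all
  countable covers of \<open>A\<close>, it suffices to consider increasing sequences of weak* compact convex sets
  whose union contains \<open>A\<close>, and to intersect the norm closures of these unions. A cover can be refined
  to such a sequence because, by the Banach-Alaoglu theorem, bounded weak* closed sets are compact,
  and the convex hull of finitely many compact convex sets is again compact, hence needs no further
  closure. The union of an increasing sequence of convex sets is convex, so it contains \<open>A\<close> exactly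
  when it contains \<open>conv A\<close>. For idempotence, enlarge all members of the sequence by a fixed ball:
  they stay compact and convex, and now they cover the norm closure.
\<close>

section \<open>The strong operator topology on scalar-valued operators\<close>

lemma Hausdorff_strong_operator_topology:
  "Hausdorff_space (strong_operator_topology ::
     ('a::real_normed_vector \<Rightarrow>\<^sub>L 'b::real_normed_vector) topology)"
proof -
  let ?T = "strong_operator_topology :: ('a \<Rightarrow>\<^sub>L 'b) topology"
  have "Hausdorff_space (product_topology (\<lambda>_::'a. euclidean :: 'b topology) UNIV)"
    by (simp add: Hausdorff_space_product_topology)
  moreover have "continuous_map ?T (product_topology (\<lambda>_::'a. euclidean :: 'b topology) UNIV) blinfun_apply"
    by (simp add: continuous_map_componentwise strong_operator_topology_continuous_evaluation)
  ultimately show ?thesis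
    by (rule Hausdorff_space_injective_preimage) (auto simp: inj_on_def blinfun_apply_inject)
qed

lemma continuous_map_strong_operator_lincomb:
  fixes f g :: "'c \<Rightarrow> 'a::real_normed_vector \<Rightarrow>\<^sub>L 'b::real_normed_vector"
  assumes "continuous_map T euclideanreal s" "continuous_map T euclideanreal t"
    and "continuous_map T strong_operator_topology f" "continuous_map T strong_operator_topology g"
  shows "continuous_map T strong_operator_topology (\<lambda>y. s y *\<^sub>R f y + t y *\<^sub>R g y)"
proof -
  have "continuous_map T euclidean (\<lambda>y. r y *\<^sub>R blinfun_apply (h y) x)"
    if "continuous_map T euclideanreal r" "continuous_map T strong_operator_topology h"
    for r and h :: "'c \<Rightarrow> 'a \<Rightarrow>\<^sub>L 'b" and x
    using that(1) that(2)[unfolded continuous_on_strong_operator_topo_iff_coordinatewise, rule_format, of x]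
    by (simp add: continuous_map_atin tendsto_scaleR)
  then show ?thesis
    using assms
    by (auto simp: continuous_on_strong_operator_topo_iff_coordinatewise[of _ "\<lambda>y. s y *\<^sub>R f y + t y *\<^sub>R g y"]
        blinfun.add_left blinfun.scaleR_left intro!: continuous_map_add)
qed

text \<open>
  The Banach-Alaoglu theorem. By Tychonoff's theorem the functions with \<open>norm (g x) \<le> r * norm x\<close>
  form a compact set for pointwise convergence, and linearity is a closed condition. The linear
  functions among them are exactly the operators of norm at most \<open>r\<close>. The scalars enter only through
  compactness of closed balls, which covers the real and the complex case at once.
\<close>

lemma compactin_cball_strong_operator:
  fixes r :: real
  shows "compactin strong_operator_topology
    (cball 0 r :: ('a::real_normed_vector \<Rightarrow>\<^sub>L 'b::{real_normed_vector,heine_borel}) set)"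
proof (cases "r \<ge> 0")
  case False
  then show ?thesis by simp
next
  case True
  define P :: "('a \<Rightarrow> 'b) set" where "P = (\<Pi>\<^sub>E x\<in>UNIV. cball 0 (r * norm x))"
  define F :: "('a \<Rightarrow> 'b) set" where
    "F = P \<inter> {g. \<forall>x y. g (x + y) = g x + g y} \<inter> {g. \<forall>c x. g (c *\<^sub>R x) = c *\<^sub>R g x}"
  have "compactin (product_topology (\<lambda>_::'a. euclidean :: 'b topology) UNIV) P"
    unfolding P_def compactin_PiE by auto
  then have "compact P"
    by (simp add: euclidean_product_topology)
  moreover have "closed {g::'a \<Rightarrow> 'b. \<forall>x y. g (x + y) = g x + g y}"
    by (intro closed_Collect_all closed_Collect_eq continuous_intros continuous_on_product_coordinates)
  moreover have "closed {g::'a \<Rightarrow> 'b. \<forall>c x. g (c *\<^sub>R x) = c *\<^sub>R g x}"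
    by (intro closed_Collect_all closed_Collect_eq continuous_intros continuous_on_product_coordinates)
  ultimately have "compact F"
    unfolding F_def by (intro compact_Int_closed)
  have bl: "bounded_linear g" if "g \<in> F" for g
    using that by (intro bounded_linear_intro[where K = r]) (auto simp: F_def P_def mult.commute)
  have "continuous_on F (\<lambda>g. g x)" for x
    by (rule continuous_on_subset[OF continuous_on_product_coordinates]) auto
  then have "continuous_on F (\<lambda>g. blinfun_apply (Blinfun g) x)" for x
    by (rule continuous_on_cong[THEN iffD1, rotated 2]) (auto simp: bounded_linear_Blinfun_apply bl)
  then have "continuous_map (top_of_set F) strong_operator_topology Blinfun"
    by (simp add: continuous_on_strong_operator_topo_iff_coordinatewise)
  moreover have "compactin (top_of_set F) F"
    using \<open>compact F\<close> by (simp add: compactin_subtopology)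
  ultimately have "compactin strong_operator_topology (Blinfun ` F)"
    by (metis image_compactin)
  moreover have "Blinfun ` F = cball 0 r"
  proof (intro equalityI subsetI)
    fix f assume "f \<in> Blinfun ` F"
    then obtain g where g: "g \<in> F" "f = Blinfun g" by auto
    have "norm (blinfun_apply f x) \<le> r * norm x" for x
      using g by (auto simp: bounded_linear_Blinfun_apply bl F_def P_def)
    then show "f \<in> cball 0 r"
      using True by (auto intro: norm_blinfun_bound)
  next
    fix f :: "'a \<Rightarrow>\<^sub>L 'b" assume "f \<in> cball 0 r"
    then have "norm (blinfun_apply f x) \<le> r * norm x" for x
      by (meson mem_cball_0 mult_right_mono norm_blinfun norm_ge_zero order_trans)
    then have "blinfun_apply f \<in> F"
      by (auto simp: F_def P_def blinfun.add_right blinfun.scaleR_right)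
    then show "f \<in> Blinfun ` F"
      by (metis blinfun_apply_inverse image_eqI)
  qed
  ultimately show ?thesis by simp
qed

lemma convex_closure_of_strong_operator:
  fixes S :: "('a::real_normed_vector \<Rightarrow>\<^sub>L 'b::real_normed_vector) set"
  assumes "convex S"
  shows "convex (strong_operator_topology closure_of S)"
proof (rule convexI)
  fix x y u v
  let ?T = "strong_operator_topology :: ('a \<Rightarrow>\<^sub>L 'b) topology"
  let ?h = "\<lambda>z :: ('a \<Rightarrow>\<^sub>L 'b) \<times> ('a \<Rightarrow>\<^sub>L 'b). u *\<^sub>R fst z + v *\<^sub>R snd z"
  assume xy: "x \<in> ?T closure_of S" "y \<in> ?T closure_of S" and uv: "0 \<le> u" "0 \<le> v" "u + v = (1::real)"
  have "continuous_map (prod_topology ?T ?T) ?T ?h"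
    by (intro continuous_map_strong_operator_lincomb continuous_map_fst continuous_map_snd) auto
  then have "?h ` (prod_topology ?T ?T closure_of (S \<times> S)) \<subseteq> ?T closure_of (?h ` (S \<times> S))"
    by (rule continuous_map_image_closure_subset)
  moreover have "?h ` (S \<times> S) \<subseteq> S"
    using assms uv by (auto intro: convexD)
  then have "?T closure_of (?h ` (S \<times> S)) \<subseteq> ?T closure_of S"
    by (rule closure_of_mono)
  moreover have "(x, y) \<in> prod_topology ?T ?T closure_of (S \<times> S)"
    using xy by (simp add: closure_of_Times)
  ultimately show "u *\<^sub>R x + v *\<^sub>R y \<in> ?T closure_of S"
    by force
qed

lemma convex_add_scaleR:
  fixes S :: "'a::real_vector set"
  assumes "convex S" "x \<in> S" "y \<in> S" "0 \<le> p" "0 \<le> q"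
  obtains z where "z \<in> S" "p *\<^sub>R x + q *\<^sub>R y = (p + q) *\<^sub>R z"
proof (cases "p + q = 0")
  case True
  then show ?thesis using that[of x] assms by (simp add: add_nonneg_eq_0_iff)
next
  case False
  let ?z = "(p / (p + q)) *\<^sub>R x + (q / (p + q)) *\<^sub>R y"
  have "?z \<in> S"
    using assms False by (intro convexD) (auto simp flip: add_divide_distrib)
  moreover have "p *\<^sub>R x + q *\<^sub>R y = (p + q) *\<^sub>R ?z"
    using False by (simp add: scaleR_add_right)
  ultimately show ?thesis by (rule that)
qed

text \<open>
  Collecting the parts of a convex combination that lie in the same set shows that segments between
  two convex sets already fill a convex set.
\<close>

lemma convex_hull_Un_convex:
  fixes S T :: "'a::real_vector set"
  assumes S: "convex S" "S \<noteq> {}" and T: "convex T" "T \<noteq> {}"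
  shows "convex hull (S \<union> T) = (\<lambda>(t, x, y). (1 - t) *\<^sub>R x + t *\<^sub>R y) ` ({0..1} \<times> S \<times> T)"
    (is "_ = ?J")
proof (rule hull_unique)
  obtain x0 y0 where "x0 \<in> S" "y0 \<in> T" using S T by auto
  show "S \<union> T \<subseteq> ?J"
  proof
    fix z assume "z \<in> S \<union> T"
    then show "z \<in> ?J"
    proof
      assume "z \<in> S"
      then show ?thesis using \<open>y0 \<in> T\<close> by (intro image_eqI[where x = "(0, z, y0)"]) auto
    next
      assume "z \<in> T"
      then show ?thesis using \<open>x0 \<in> S\<close> by (intro image_eqI[where x = "(1, x0, z)"]) auto
    qed
  qed
  show "convex ?J"
  proof (rule convexI)
    fix a b u v assume "a \<in> ?J" "b \<in> ?J" and uv: "0 \<le> u" "0 \<le> v" "u + v = (1::real)"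
    then obtain s x y t x' y' where
      a: "a = (1 - s) *\<^sub>R x + s *\<^sub>R y" "0 \<le> s" "s \<le> 1" "x \<in> S" "y \<in> T" and
      b: "b = (1 - t) *\<^sub>R x' + t *\<^sub>R y'" "0 \<le> t" "t \<le> 1" "x' \<in> S" "y' \<in> T"
      by force
    obtain p where p: "p \<in> S"
      "(u * (1 - s)) *\<^sub>R x + (v * (1 - t)) *\<^sub>R x' = (u * (1 - s) + v * (1 - t)) *\<^sub>R p"
      using convex_add_scaleR[OF S(1) a(4) b(4), of "u * (1 - s)" "v * (1 - t)"] uv a b by auto
    obtain q where q: "q \<in> T" "(u * s) *\<^sub>R y + (v * t) *\<^sub>R y' = (u * s + v * t) *\<^sub>R q"
      using convex_add_scaleR[OF T(1) a(5) b(5), of "u * s" "v * t"] uv a b by auto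
    have eq: "u * (1 - s) + v * (1 - t) = 1 - (u * s + v * t)"
      using uv by (simp add: algebra_simps)
    have "u *\<^sub>R a + v *\<^sub>R b = ((u * (1 - s)) *\<^sub>R x + (v * (1 - t)) *\<^sub>R x') + ((u * s) *\<^sub>R y + (v * t) *\<^sub>R y')"
      unfolding a b by (simp add: scaleR_add_right)
    also have "\<dots> = (1 - (u * s + v * t)) *\<^sub>R p + (u * s + v * t) *\<^sub>R q"
      unfolding p q eq ..
    finally have *: "u *\<^sub>R a + v *\<^sub>R b = (1 - (u * s + v * t)) *\<^sub>R p + (u * s + v * t) *\<^sub>R q" .
    have "u * s + v * t \<le> u * 1 + v * 1"
      using uv a b by (intro add_mono mult_left_mono) auto
    then have "u * s + v * t \<in> {0..1}" using uv a b by auto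
    with p q * show "u *\<^sub>R a + v *\<^sub>R b \<in> ?J"
      by (intro image_eqI[where x = "(u * s + v * t, p, q)"]) auto
  qed
  show "?J \<subseteq> C" if "S \<union> T \<subseteq> C" "convex C" for C
    using that by (auto intro!: convexD)
qed

text \<open>
  The hull is the image of the compact set \<open>{0..1} \<times> S \<times> T\<close> under a continuous map.
\<close>

lemma compactin_convex_hull_Un:
  fixes S T :: "('a::real_normed_vector \<Rightarrow>\<^sub>L 'b::real_normed_vector) set"
  assumes "convex S" "compactin strong_operator_topology S"
    and "convex T" "compactin strong_operator_topology T"
  shows "compactin strong_operator_topology (convex hull (S \<union> T))"
proof (cases "S = {} \<or> T = {}")
  case True
  then show ?thesis using assms by (auto simp: hull_same)
next
  case False
  let ?T = "strong_operator_topology :: ('a \<Rightarrow>\<^sub>L 'b) topology"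
  let ?h = "\<lambda>z :: real \<times> ('a \<Rightarrow>\<^sub>L 'b) \<times> ('a \<Rightarrow>\<^sub>L 'b). (1 - fst z) *\<^sub>R fst (snd z) + fst z *\<^sub>R snd (snd z)"
  let ?P = "prod_topology euclideanreal (prod_topology ?T ?T)"
  have s: "continuous_map ?P (prod_topology ?T ?T) snd"
    by (rule continuous_map_snd)
  have c: "continuous_map ?P ?T ?h"
    by (intro continuous_map_strong_operator_lincomb continuous_map_diff continuous_map_fst
        continuous_map_compose[OF s continuous_map_fst, unfolded o_def]
        continuous_map_compose[OF s continuous_map_snd, unfolded o_def]) auto
  have "compactin ?P ({0..1} \<times> S \<times> T)"
    using assms by (simp add: compactin_Times)
  from image_compactin[OF this c] show ?thesis
    using False assms by (simp add: convex_hull_Un_convex case_prod_unfold)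
qed

lemma compactin_convex_hull_UN:
  fixes S :: "'i \<Rightarrow> ('a::real_normed_vector \<Rightarrow>\<^sub>L 'b::real_normed_vector) set"
  assumes "finite I" and "\<And>i. i \<in> I \<Longrightarrow> convex (S i)"
    and "\<And>i. i \<in> I \<Longrightarrow> compactin strong_operator_topology (S i)"
  shows "compactin strong_operator_topology (convex hull (\<Union>i\<in>I. S i))"
  using assms
proof (induction I)
  case empty
  then show ?case by simp
next
  case (insert i I)
  have "convex hull (\<Union>j\<in>insert i I. S j) = convex hull (S i \<union> convex hull (\<Union>j\<in>I. S j))"
    by (simp flip: hull_Un_right)
  also have "compactin strong_operator_topology \<dots>"
    using insert by (intro compactin_convex_hull_Un) auto
  finally show ?case .
qed

lemma compactin_strong_operator_plus_cball:
  fixes S :: "('a::real_normed_vector \<Rightarrow>\<^sub>L 'b::{real_normed_vector,heine_borel}) set"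
  assumes "compactin strong_operator_topology S"
  shows "compactin strong_operator_topology (S + cball 0 e)"
proof -
  let ?T = "strong_operator_topology :: ('a \<Rightarrow>\<^sub>L 'b) topology"
  let ?h = "\<lambda>z :: ('a \<Rightarrow>\<^sub>L 'b) \<times> ('a \<Rightarrow>\<^sub>L 'b). 1 *\<^sub>R fst z + 1 *\<^sub>R snd z"
  have "continuous_map (prod_topology ?T ?T) ?T ?h"
    by (intro continuous_map_strong_operator_lincomb continuous_map_fst continuous_map_snd) auto
  moreover have "compactin (prod_topology ?T ?T) (S \<times> cball 0 e)"
    using assms by (simp add: compactin_Times compactin_cball_strong_operator)
  ultimately have "compactin ?T (?h ` (S \<times> cball 0 e))"
    by (rule image_compactin[rotated])
  moreover have "?h ` (S \<times> cball 0 e) = S + cball 0 e"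
    by (simp add: set_plus_image case_prod_unfold)
  ultimately show ?thesis by simp
qed

section \<open>The envelope through exhaustions\<close>

text \<open>
  The condition mentions pointwise convergence only and not the scalar multiplication, so that the
  envelope can be studied in the space of all bounded real-linear operators.
\<close>

definition exhaustion :: "(nat \<Rightarrow> ('a::real_normed_vector \<Rightarrow>\<^sub>L 'b::real_normed_vector) set) \<Rightarrow> bool" where
  "exhaustion K \<longleftrightarrow> mono K \<and> (\<forall>n. convex (K n) \<and> compactin strong_operator_topology (K n))"

lemma exhaustion_closedin: "exhaustion K \<Longrightarrow> closedin strong_operator_topology (K n)"
  by (auto simp: exhaustion_def intro: compactin_imp_closedin Hausdorff_strong_operator_topology)

lemma convex_UN_mono:
  fixes K :: "nat \<Rightarrow> 'a::real_vector set"
  assumes "mono K" "\<And>n. convex (K n)"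
  shows "convex (\<Union>n. K n)"
proof (rule convexI)
  fix x y u v assume "x \<in> (\<Union>n. K n)" "y \<in> (\<Union>n. K n)" and uv: "0 \<le> u" "0 \<le> v" "u + v = (1::real)"
  then obtain m n where "x \<in> K m" "y \<in> K n" by auto
  then have "x \<in> K (max m n)" "y \<in> K (max m n)"
    using monoD[OF assms(1), of m "max m n"] monoD[OF assms(1), of n "max m n"] by auto
  then have "u *\<^sub>R x + v *\<^sub>R y \<in> K (max m n)"
    using convexD[OF assms(2)] uv by blast
  then show "u *\<^sub>R x + v *\<^sub>R y \<in> (\<Union>n. K n)" by blast
qed

lemma convex_exhaustion: "exhaustion K \<Longrightarrow> convex (\<Union>n. K n)"
  by (simp add: exhaustion_def convex_UN_mono)

text \<open>
  Homogeneity over the scalars consists of closed conditions on the values at points. Therefore the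
  weak* closure of a subset of the dual can be computed in the space of all bounded real-linear
  operators.
\<close>

lemma closedin_continuous_dual:
  "closedin strong_operator_topology (continuous_dual smul)"
proof -
  have "closedin strong_operator_topology {f \<in> topspace strong_operator_topology.
          blinfun_apply f (smul c x) - c * blinfun_apply f x \<in> {0}}" for c x
    by (intro closedin_continuous_map_preimage[where Y = euclidean] continuous_map_diff
        strong_operator_topology_continuous_evaluation
        continuous_map_compose[OF strong_operator_topology_continuous_evaluation,
          where g = "(*) c" and X'' = euclidean, unfolded o_def])
      (auto intro!: continuous_intros)
  then have "closedin strong_operator_topology (\<Inter>c. \<Inter>x. {f. blinfun_apply f (smul c x) = c * blinfun_apply f x})"
    by (intro closedin_Inter) (auto simp: strong_operator_topology_topspace)
  moreover have "(\<Inter>c. \<Inter>x. {f. blinfun_apply f (smul c x) = c * blinfun_apply f x}) = continuous_dual smul"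
    by (auto simp: continuous_dual_def)
  ultimately show ?thesis by simp
qed

lemma closed_continuous_dual: "closed (continuous_dual smul)"
proof -
  have "closedin euclidean {f \<in> topspace euclidean. f \<in> continuous_dual smul}"
    by (rule closedin_continuous_map_preimage[OF strong_operator_topology_weaker_than_euclidean
          closedin_continuous_dual])
  then show ?thesis by simp
qed

lemma convex_continuous_dual: "convex (continuous_dual smul)"
  by (rule convexI) (simp add: continuous_dual_def blinfun.add_left blinfun.scaleR_left algebra_simps)

lemma weak_star_closure_of_eq:
  assumes "S \<subseteq> continuous_dual smul"
  shows "weak_star smul closure_of S = strong_operator_topology closure_of S"
  using closure_of_minimal[OF assms closedin_continuous_dual] assms
  unfolding weak_star_def by (auto simp: closure_of_subtopology Int_absorb1)

text \<open>
  The sets \<open>B i\<close> may be unbounded, so their weak* closed hulls need not be compact, and the hull of two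
  of them need not be weak* closed. Cutting \<open>B i\<close> down to the ball of radius \<open>n\<close> restores compactness;
  at stage \<open>n\<close> the pieces with \<open>i \<le> n\<close> are joined, and every point of every \<open>B i\<close> appears from some
  stage on.
\<close>

lemma exhaustion_inside_cover:
  fixes smul :: "'k::{real_normed_field,heine_borel} \<Rightarrow> 'a::banach \<Rightarrow> 'a"
    and B :: "nat \<Rightarrow> ('a \<Rightarrow>\<^sub>L 'k) set"
  assumes B: "(\<Union>n. B n) \<subseteq> continuous_dual smul"
  obtains K where "exhaustion K" "(\<Union>n. B n) \<subseteq> (\<Union>n. K n)"
    "(\<Union>n. K n) \<subseteq> convex hull (\<Union>n. weak_star smul closure_of (convex hull (B n)))"
proof
  let ?T = "strong_operator_topology :: ('a \<Rightarrow>\<^sub>L 'k) topology"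
  define L where "L n i = ?T closure_of (convex hull (B i \<inter> cball 0 (real n)))" for n i
  define K where "K n = convex hull (\<Union>i\<le>n. L n i)" for n
  have Lmono: "L m i \<subseteq> L n i" if "m \<le> n" for m n i
    unfolding L_def using that by (intro closure_of_mono hull_mono) auto
  have "convex (L n i)" for n i
    unfolding L_def by (intro convex_closure_of_strong_operator convex_convex_hull)
  moreover have "compactin ?T (L n i)" for n i
  proof (rule closed_compactin[OF compactin_cball_strong_operator])
    show "closedin ?T (L n i)" by (simp add: L_def)
    have "closedin ?T (cball 0 (real n))"
      by (intro compactin_imp_closedin Hausdorff_strong_operator_topology compactin_cball_strong_operator)
    moreover have "convex hull (B i \<inter> cball 0 (real n)) \<subseteq> cball 0 (real n)"
      by (rule hull_minimal) auto
    ultimately show "L n i \<subseteq> cball 0 (real n)"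
      unfolding L_def by (intro closure_of_minimal)
  qed
  ultimately have "compactin ?T (K n)" for n
    unfolding K_def by (intro compactin_convex_hull_UN) auto
  moreover have "mono K"
    unfolding K_def using Lmono by (intro monoI hull_mono UN_mono) auto
  ultimately show "exhaustion K" by (simp add: exhaustion_def K_def)
  show "(\<Union>n. B n) \<subseteq> (\<Union>n. K n)"
  proof
    fix b assume "b \<in> (\<Union>n. B n)"
    then obtain i where i: "b \<in> B i" by auto
    obtain m where m: "norm b \<le> real m" using real_arch_simple by blast
    have "b \<in> convex hull (B i \<inter> cball 0 (real (max i m)))"
      using i m by (intro hull_inc) auto
    then have "b \<in> L (max i m) i"
      unfolding L_def by (metis closure_of_subset strong_operator_topology_topspace subsetD subset_UNIV)
    then have "b \<in> K (max i m)"
      unfolding K_def by (intro hull_inc) auto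
    then show "b \<in> (\<Union>n. K n)" by blast
  qed
  have "L n i \<subseteq> weak_star smul closure_of (convex hull (B i))" for n i
  proof -
    have "convex hull (B i) \<subseteq> continuous_dual smul"
      using B by (intro hull_minimal convex_continuous_dual) auto
    then show ?thesis
      unfolding L_def by (simp add: weak_star_closure_of_eq closure_of_mono hull_mono)
  qed
  then show "(\<Union>n. K n) \<subseteq> convex hull (\<Union>n. weak_star smul closure_of (convex hull (B n)))"
    unfolding K_def by (intro UN_least hull_mono) blast
qed

text \<open>
  An exhaustion \<open>K\<close> induces the cover by the sets \<open>A \<inter> K n\<close>, whose weak* closed convex hulls stay inside
  \<open>K n\<close>. Conversely every cover is refined by an exhaustion, by the preceding lemma.
\<close>

lemma I_env_eq_exhaustions:
  fixes smul :: "'k::{real_normed_field,heine_borel} \<Rightarrow> 'a::banach \<Rightarrow> 'a"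
  assumes "A \<subseteq> continuous_dual smul"
  shows "I_env smul A = \<Inter> {closure (\<Union>n. K n) | K. exhaustion K \<and> A \<subseteq> (\<Union>n. K n)}"
proof (intro equalityI subsetI)
  fix f assume f: "f \<in> I_env smul A"
  have "f \<in> closure (\<Union>n. K n)" if K: "exhaustion K" "A \<subseteq> (\<Union>n. K n)" for K
  proof -
    have "weak_star smul closure_of (convex hull (A \<inter> K n)) \<subseteq> K n" for n
    proof -
      have "convex hull (A \<inter> K n) \<subseteq> continuous_dual smul"
        using assms by (intro hull_minimal convex_continuous_dual) auto
      moreover have "convex hull (A \<inter> K n) \<subseteq> K n"
        using K(1) by (intro hull_minimal) (auto simp: exhaustion_def)
      ultimately show ?thesis
        using exhaustion_closedin[OF K(1)] by (simp add: weak_star_closure_of_eq closure_of_minimal)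
    qed
    then have "convex hull (\<Union>n. weak_star smul closure_of (convex hull (A \<inter> K n))) \<subseteq> (\<Union>n. K n)"
      using K(1) by (intro hull_minimal convex_exhaustion) auto
    moreover have "A = (\<Union>n. A \<inter> K n)" using K(2) by auto
    then have "f \<in> closure (convex hull (\<Union>n. weak_star smul closure_of (convex hull (A \<inter> K n))))"
      using f unfolding I_env_def by blast
    ultimately show ?thesis using closure_mono by blast
  qed
  then show "f \<in> \<Inter> {closure (\<Union>n. K n) | K. exhaustion K \<and> A \<subseteq> (\<Union>n. K n)}" by blast
next
  fix f assume f: "f \<in> \<Inter> {closure (\<Union>n. K n) | K. exhaustion K \<and> A \<subseteq> (\<Union>n. K n)}"
  have "f \<in> closure (convex hull (\<Union>n. weak_star smul closure_of (convex hull (B n))))"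
    if B: "A = (\<Union>n. B n)" for B :: "nat \<Rightarrow> ('a \<Rightarrow>\<^sub>L 'k) set"
  proof -
    obtain K where K: "exhaustion K" "A \<subseteq> (\<Union>n. K n)"
      "(\<Union>n. K n) \<subseteq> convex hull (\<Union>n. weak_star smul closure_of (convex hull (B n)))"
      using exhaustion_inside_cover[of B smul] assms B by auto
    then show ?thesis using f closure_mono[OF K(3)] by blast
  qed
  then show "f \<in> I_env smul A" unfolding I_env_def by blast
qed

section \<open>The envelope as a closure operator\<close>

lemma I_env_superset:
  fixes smul :: "'k::{real_normed_field,heine_borel} \<Rightarrow> 'a::banach \<Rightarrow> 'a"
  shows "A \<subseteq> continuous_dual smul \<Longrightarrow> A \<subseteq> I_env smul A"
  unfolding I_env_eq_exhaustions using closure_subset by blast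

lemma I_env_mono:
  fixes smul :: "'k::{real_normed_field,heine_borel} \<Rightarrow> 'a::banach \<Rightarrow> 'a"
  assumes "A \<subseteq> B" "B \<subseteq> continuous_dual smul"
  shows "I_env smul A \<subseteq> I_env smul B"
proof -
  have A: "A \<subseteq> continuous_dual smul" using assms by simp
  show ?thesis
    unfolding I_env_eq_exhaustions[OF A] I_env_eq_exhaustions[OF assms(2)]
    using assms(1) by blast
qed

lemma convex_I_env: "convex (I_env smul A)"
  unfolding I_env_def by (intro convex_Inter) (auto intro: convex_closure)

lemma I_env_subset_continuous_dual:
  assumes "A \<subseteq> continuous_dual smul"
  shows "I_env smul A \<subseteq> continuous_dual smul"
proof -
  have "weak_star smul closure_of (convex hull A) \<subseteq> continuous_dual smul"
    unfolding weak_star_def by (simp add: closure_of_subtopology)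
  then have "closure (convex hull (\<Union>n::nat. weak_star smul closure_of (convex hull A)))
      \<subseteq> continuous_dual smul"
    by (intro closure_minimal hull_minimal closed_continuous_dual convex_continuous_dual) auto
  moreover have "A = (\<Union>n::nat. A)" by simp
  ultimately show ?thesis unfolding I_env_def by blast
qed

lemma I_env_empty: "I_env smul {} = {}"
proof -
  have "I_env smul {} \<subseteq> closure (convex hull (\<Union>n::nat. weak_star smul closure_of (convex hull {})))"
    unfolding I_env_def by (intro Inter_lower CollectI exI[of _ "\<lambda>_. {}"]) simp
  then show ?thesis by simp
qed

lemma I_env_convex_hull:
  fixes smul :: "'k::{real_normed_field,heine_borel} \<Rightarrow> 'a::banach \<Rightarrow> 'a"
  assumes "A \<subseteq> continuous_dual smul"
  shows "I_env smul (convex hull A) = I_env smul A"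
proof -
  have hull: "convex hull A \<subseteq> continuous_dual smul"
    using assms by (intro hull_minimal convex_continuous_dual)
  have "convex hull A \<subseteq> (\<Union>n. K n) \<longleftrightarrow> A \<subseteq> (\<Union>n. K n)"
    if "exhaustion K" for K :: "nat \<Rightarrow> ('a \<Rightarrow>\<^sub>L 'k) set"
    using convex_exhaustion[OF that] hull_minimal[of A "\<Union>n. K n" convex] hull_subset[of A convex]
    by auto
  then show ?thesis
    unfolding I_env_eq_exhaustions[OF hull] I_env_eq_exhaustions[OF assms]
    by (intro arg_cong[where f = Inter] Collect_cong ex_cong1 conj_cong refl)
qed

text \<open>
  If \<open>K\<close> exhausts \<open>A\<close>, the envelope of \<open>A\<close> lies in the norm closure of the union of the \<open>K n\<close>. Hence it
  is exhausted by the sets \<open>K n + cball 0 (e/2)\<close>, which are compact as sums of compact sets. Every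
  point of the second envelope is therefore within \<open>e\<close> of some \<open>K n\<close>, for every \<open>e > 0\<close>.
\<close>

lemma I_env_idem:
  fixes smul :: "'k::{real_normed_field,heine_borel} \<Rightarrow> 'a::banach \<Rightarrow> 'a"
  assumes A: "A \<subseteq> continuous_dual smul"
  shows "I_env smul (I_env smul A) = I_env smul A"
proof
  note IA = I_env_subset_continuous_dual[OF A]
  show "I_env smul A \<subseteq> I_env smul (I_env smul A)"
    using IA by (rule I_env_superset)
  have "f \<in> closure (\<Union>n. K n)"
    if f: "f \<in> I_env smul (I_env smul A)" and K: "exhaustion K" "A \<subseteq> (\<Union>n. K n)" for f K
    unfolding closure_approachable
  proof (intro allI impI)
    fix e :: real assume "e > 0"
    define K' where "K' n = K n + cball 0 (e/2)" for n
    have "exhaustion K'"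
      unfolding exhaustion_def K'_def
    proof (intro conjI monoI allI)
      show "K m + cball 0 (e/2) \<subseteq> K n + cball 0 (e/2)" if "m \<le> n" for m n
        using K(1) that by (intro set_plus_mono2) (auto simp: exhaustion_def dest: monoD)
      show "convex (K n + cball 0 (e/2))" for n
        using K(1) by (intro convex_set_plus) (auto simp: exhaustion_def)
      show "compactin strong_operator_topology (K n + cball 0 (e/2))" for n
        using K(1) by (intro compactin_strong_operator_plus_cball) (auto simp: exhaustion_def)
    qed
    moreover have "I_env smul A \<subseteq> (\<Union>n. K' n)"
    proof
      fix g assume "g \<in> I_env smul A"
      then have "g \<in> closure (\<Union>n. K n)"
        using K unfolding I_env_eq_exhaustions[OF A] by blast
      then obtain n h where h: "h \<in> K n" "dist h g < e/2"
        using \<open>e > 0\<close> unfolding closure_approachable by (metis UN_E half_gt_zero)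
      then have "h + (g - h) \<in> K' n"
        unfolding K'_def by (intro set_plus_intro) (auto simp: dist_norm norm_minus_commute)
      then show "g \<in> (\<Union>n. K' n)" by auto
    qed
    ultimately have "f \<in> closure (\<Union>n. K' n)"
      using f unfolding I_env_eq_exhaustions[OF IA] by blast
    then obtain n g where g: "g \<in> K' n" "dist g f < e/2"
      using \<open>e > 0\<close> unfolding closure_approachable by (metis UN_E half_gt_zero)
    then obtain h b where "h \<in> K n" "norm b \<le> e/2" "g = h + b"
      unfolding K'_def by (auto elim!: set_plus_elim)
    then have "dist h g \<le> e/2" by (simp add: dist_norm)
    then have "dist h f < e"
      using dist_triangle[of h f g] g(2) by linarith
    then show "\<exists>y\<in>(\<Union>n. K n). dist y f < e" using \<open>h \<in> K n\<close> by blast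
  qed
  then show "I_env smul (I_env smul A) \<subseteq> I_env smul A"
    unfolding I_env_eq_exhaustions[OF A] by blast
qed

section \<open>The topology generated by finite covers\<close>

text \<open>
  Finite families are easier to combine and restrict than sequences indexed by \<open>{1..n}\<close>. The empty
  family, which is not among those sequences, makes no difference: it covers only the empty set, whose
  envelope is empty.
\<close>

lemma mem_cl_IF_iff:
  "f \<in> cl_IF smul A \<longleftrightarrow> (\<forall>F. finite F \<and> \<Union>F = A \<longrightarrow> (\<exists>B\<in>F. f \<in> I_env smul B))"
  (is "_ = ?R")
proof
  assume f: "f \<in> cl_IF smul A"
  show ?R
  proof (intro allI impI)
    fix F assume F: "finite F \<and> \<Union>F = A"
    show "\<exists>B\<in>F. f \<in> I_env smul B"
    proof (cases "F = {}")
      case True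
      then have "A = (\<Union>j\<in>{1..1::nat}. {})" using F by auto
      then have "f \<in> (\<Union>j\<in>{1..1::nat}. I_env smul {})"
        using f unfolding cl_IF_def by blast
      then show ?thesis by (simp add: I_env_empty)
    next
      case False
      obtain h where "bij_betw h {1..card F} F"
        using F ex_bij_betw_nat_finite_1 by blast
      then have h: "h ` {1..card F} = F" by (simp add: bij_betw_def)
      moreover have "1 \<le> card F" using F False by (simp add: Suc_leI card_gt_0_iff)
      moreover have "A = (\<Union>j\<in>{1..card F}. h j)" using F h by simp
      ultimately have "f \<in> (\<Union>j\<in>{1..card F}. I_env smul (h j))"
        using f unfolding cl_IF_def by blast
      then show ?thesis using h by blast
    qed
  qed
next
  assume R: ?R
  have "f \<in> (\<Union>j\<in>{1..n}. I_env smul (B j))" if "A = (\<Union>j\<in>{1..n}. B j)" for n :: nat and B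
    using R[rule_format, of "B ` {1..n}"] that by auto
  then show "f \<in> cl_IF smul A" unfolding cl_IF_def by blast
qed

lemma cl_IF_subset_I_env: "cl_IF smul A \<subseteq> I_env smul A"
proof
  fix f assume "f \<in> cl_IF smul A"
  from this[unfolded mem_cl_IF_iff, rule_format, of "{A}"] show "f \<in> I_env smul A" by auto
qed

lemma cl_IF_mono:
  fixes smul :: "'k::{real_normed_field,heine_borel} \<Rightarrow> 'a::banach \<Rightarrow> 'a"
  assumes "A \<subseteq> B" "B \<subseteq> continuous_dual smul"
  shows "cl_IF smul A \<subseteq> cl_IF smul B"
proof
  fix f assume f: "f \<in> cl_IF smul A"
  show "f \<in> cl_IF smul B"
    unfolding mem_cl_IF_iff
  proof (intro allI impI)
    fix F assume F: "finite F \<and> \<Union>F = B"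
    then have "finite ((\<inter>) A ` F) \<and> \<Union>((\<inter>) A ` F) = A" using assms(1) by auto
    then obtain C where C: "C \<in> F" "f \<in> I_env smul (A \<inter> C)"
      using f[unfolded mem_cl_IF_iff, rule_format, of "(\<inter>) A ` F"] by auto
    moreover have "I_env smul (A \<inter> C) \<subseteq> I_env smul C"
      using F C(1) assms by (intro I_env_mono) auto
    ultimately show "\<exists>C\<in>F. f \<in> I_env smul C" by blast
  qed
qed

text \<open>
  If a cover of \<open>A\<close> and a cover of \<open>B\<close> both exclude \<open>f\<close>, so does their union, which covers \<open>A \<union> B\<close>.
\<close>

lemma cl_IF_Un_subset:
  "cl_IF smul (A \<union> B) \<subseteq> cl_IF smul A \<union> cl_IF smul B"
proof (rule subsetI, rule ccontr)
  fix f assume f: "f \<in> cl_IF smul (A \<union> B)" and "f \<notin> cl_IF smul A \<union> cl_IF smul B"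
  then obtain F G where F: "finite F" "\<Union>F = A" "\<forall>C\<in>F. f \<notin> I_env smul C"
    and G: "finite G" "\<Union>G = B" "\<forall>C\<in>G. f \<notin> I_env smul C"
    unfolding Un_iff mem_cl_IF_iff by blast
  from f[unfolded mem_cl_IF_iff, rule_format, of "F \<union> G"] F G show False by auto
qed

text \<open>
  The conditions say that the complement \<open>F\<close> of an open set in the dual satisfies \<open>cl_IF F \<subseteq> F\<close>; the
  closed sets are these \<open>F\<close>. If the \<open>cl_IF\<close> of a set is closed, then it is the closure of that set.
\<close>

definition IF_topology ::
    "('k::real_normed_field \<Rightarrow> 'a::banach \<Rightarrow> 'a) \<Rightarrow> ('a \<Rightarrow>\<^sub>L 'k) topology" where
  "IF_topology smul = topology (\<lambda>U. U \<subseteq> continuous_dual smul \<and>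
     cl_IF smul (continuous_dual smul - U) \<subseteq> continuous_dual smul - U)"

lemma openin_IF_topology:
  fixes smul :: "'k::{real_normed_field,heine_borel} \<Rightarrow> 'a::banach \<Rightarrow> 'a"
  shows "openin (IF_topology smul) U \<longleftrightarrow> U \<subseteq> continuous_dual smul \<and>
     cl_IF smul (continuous_dual smul - U) \<subseteq> continuous_dual smul - U"
proof -
  let ?D = "continuous_dual smul"
  let ?L = "\<lambda>U. U \<subseteq> ?D \<and> cl_IF smul (?D - U) \<subseteq> ?D - U"
  have "istopology ?L"
    unfolding istopology_def
  proof (intro conjI allI impI)
    fix S T assume "?L S" "?L T"
    then show "S \<inter> T \<subseteq> ?D" "cl_IF smul (?D - S \<inter> T) \<subseteq> ?D - S \<inter> T"
      using cl_IF_Un_subset[of smul "?D - S" "?D - T"] by (auto simp: Diff_Int)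
  next
    fix \<K> assume \<K>: "\<forall>U\<in>\<K>. ?L U"
    then show "\<Union>\<K> \<subseteq> ?D" by blast
    have "cl_IF smul (?D - \<Union>\<K>) \<subseteq> cl_IF smul (?D - U)" if "U \<in> \<K>" for U
      using that by (intro cl_IF_mono) auto
    moreover have "cl_IF smul (?D - \<Union>\<K>) \<subseteq> ?D"
      using cl_IF_subset_I_env[of smul "?D - \<Union>\<K>"] I_env_subset_continuous_dual[of "?D - \<Union>\<K>" smul] by auto
    ultimately show "cl_IF smul (?D - \<Union>\<K>) \<subseteq> ?D - \<Union>\<K>"
      using \<K> by blast
  qed
  then show ?thesis unfolding IF_topology_def by simp
qed

lemma topspace_IF_topology:
  fixes smul :: "'k::{real_normed_field,heine_borel} \<Rightarrow> 'a::banach \<Rightarrow> 'a"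
  shows "topspace (IF_topology smul) = continuous_dual smul"
proof
  show "topspace (IF_topology smul) \<subseteq> continuous_dual smul"
    using openin_topspace[of "IF_topology smul"] unfolding openin_IF_topology by blast
  have "openin (IF_topology smul) (continuous_dual smul)"
    using cl_IF_subset_I_env[of smul "{}"] unfolding openin_IF_topology by (simp add: I_env_empty)
  then show "continuous_dual smul \<subseteq> topspace (IF_topology smul)"
    by (rule openin_subset)
qed

lemma closedin_IF_topology:
  fixes smul :: "'k::{real_normed_field,heine_borel} \<Rightarrow> 'a::banach \<Rightarrow> 'a"
  shows "closedin (IF_topology smul) F \<longleftrightarrow> F \<subseteq> continuous_dual smul \<and> cl_IF smul F \<subseteq> F"
proof -
  have "continuous_dual smul - (continuous_dual smul - F) = F" if "F \<subseteq> continuous_dual smul"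
    using that by auto
  then show ?thesis
    unfolding closedin_def openin_IF_topology topspace_IF_topology by auto
qed

section \<open>The equivalence\<close>

lemma topological_closure_imp_preserves_unions:
  fixes smul :: "'k::real_normed_field \<Rightarrow> 'a::banach \<Rightarrow> 'a"
  assumes "I_env_is_topological_closure smul"
  shows "I_env_preserves_convex_finite_unions smul"
proof -
  obtain \<tau> where \<tau>: "\<And>A. A \<subseteq> continuous_dual smul \<Longrightarrow> I_env smul A = \<tau> closure_of (convex hull A)"
    using assms unfolding I_env_is_topological_closure_def by blast
  show ?thesis
    unfolding I_env_preserves_convex_finite_unions_def
  proof (intro allI impI, elim conjE)
    fix n :: nat and A :: "nat \<Rightarrow> ('a \<Rightarrow>\<^sub>L 'k) set"
    assume A: "\<forall>j\<in>{1..n}. A j \<subseteq> continuous_dual smul \<and> convex (A j)"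
      and U: "convex (\<Union>j\<in>{1..n}. A j)"
    have "I_env smul (\<Union>j\<in>{1..n}. A j) = \<tau> closure_of (\<Union>j\<in>{1..n}. A j)"
      using A U by (subst \<tau>) (auto simp: hull_same)
    also have "\<dots> = (\<Union>j\<in>{1..n}. \<tau> closure_of A j)"
      by (simp add: closure_of_Union image_image)
    also have "\<dots> = (\<Union>j\<in>{1..n}. I_env smul (A j))"
      using A by (intro SUP_cong) (auto simp: \<tau> hull_same)
    finally show "I_env smul (\<Union>j\<in>{1..n}. A j) = (\<Union>j\<in>{1..n}. I_env smul (A j))" .
  qed
qed

text \<open>
  Replacing the members of a cover of \<open>conv A\<close> by their convex hulls changes neither their union, which
  is convex already, nor their envelopes.
\<close>

lemma preserves_unions_imp_eq_cl_IF:
  fixes smul :: "'k::{real_normed_field,heine_borel} \<Rightarrow> 'a::banach \<Rightarrow> 'a"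
  assumes "I_env_preserves_convex_finite_unions smul"
  shows "I_env_eq_cl_IF_convex_hull smul"
  unfolding I_env_eq_cl_IF_convex_hull_def
proof (intro allI impI equalityI)
  fix A assume A: "A \<subseteq> continuous_dual smul"
  show "cl_IF smul (convex hull A) \<subseteq> I_env smul A"
    using cl_IF_subset_I_env[of smul "convex hull A"] I_env_convex_hull[OF A] by simp
  have hull: "convex hull A \<subseteq> continuous_dual smul"
    using A by (intro hull_minimal convex_continuous_dual)
  have "I_env smul A = (\<Union>j\<in>{1..n}. I_env smul (B j))"
    if n: "1 \<le> n" and B: "convex hull A = (\<Union>j\<in>{1..n}. B j)" for n :: nat and B
  proof -
    have sub: "B j \<subseteq> convex hull A" if "j \<in> {1..n}" for j
      using that B by blast
    then have hsub: "convex hull (B j) \<subseteq> convex hull A" if "j \<in> {1..n}" for j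
      using that by (intro hull_minimal) auto
    have eq: "(\<Union>j\<in>{1..n}. convex hull (B j)) = convex hull A"
      using hsub B hull_subset[of _ convex] by blast
    have "I_env smul A = I_env smul (\<Union>j\<in>{1..n}. convex hull (B j))"
      by (simp only: eq I_env_convex_hull[OF A])
    also have "\<dots> = (\<Union>j\<in>{1..n}. I_env smul (convex hull (B j)))"
      using assms[unfolded I_env_preserves_convex_finite_unions_def, rule_format, of n "\<lambda>j. convex hull (B j)"]
        n hsub hull eq by (metis convex_convex_hull subset_trans)
    also have "\<dots> = (\<Union>j\<in>{1..n}. I_env smul (B j))"
      using sub hull by (intro SUP_cong refl I_env_convex_hull) (meson subset_trans)
    finally show ?thesis .
  qed
  then show "I_env smul A \<subseteq> cl_IF smul (convex hull A)"
    unfolding cl_IF_def by blast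
qed

text \<open>
  The hypothesis is applied twice: to \<open>A\<close>, and to the convex set \<open>I_env A\<close>, which gives
  \<open>cl_IF (I_env A) = I_env (I_env A) = I_env A\<close> and so makes \<open>I_env A\<close> closed.
\<close>

lemma eq_cl_IF_imp_topological_closure:
  fixes smul :: "'k::{real_normed_field,heine_borel} \<Rightarrow> 'a::banach \<Rightarrow> 'a"
  assumes "I_env_eq_cl_IF_convex_hull smul"
  shows "I_env_is_topological_closure smul"
  unfolding I_env_is_topological_closure_def
proof (intro exI conjI allI impI)
  have eq: "I_env smul A = cl_IF smul (convex hull A)" if "A \<subseteq> continuous_dual smul" for A
    using assms that by (simp add: I_env_eq_cl_IF_convex_hull_def)
  show "topspace (IF_topology smul) = continuous_dual smul"
    by (rule topspace_IF_topology)
  fix A assume A: "A \<subseteq> continuous_dual smul"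
  note IA = I_env_subset_continuous_dual[OF A]
  have "cl_IF smul (I_env smul A) = I_env smul A"
    using eq[OF IA] I_env_idem[OF A] by (simp add: hull_same convex_I_env)
  then have "closedin (IF_topology smul) (I_env smul A)"
    using IA by (simp add: closedin_IF_topology)
  moreover have "convex hull A \<subseteq> I_env smul A"
    by (intro hull_minimal I_env_superset A convex_I_env)
  moreover have "I_env smul A \<subseteq> F" if "convex hull A \<subseteq> F" "closedin (IF_topology smul) F" for F
    using that cl_IF_mono[of "convex hull A" F smul] eq[OF A] by (auto simp: closedin_IF_topology)
  ultimately show "I_env smul A = IF_topology smul closure_of (convex hull A)"
    by (metis closure_of_unique)
qed

theorem theorem4p3:
  shows
    "(let s = ((*\<^sub>R) :: real \<Rightarrow> 'a::banach \<Rightarrow> 'a) in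
        (I_env_is_topological_closure s \<longleftrightarrow> I_env_preserves_convex_finite_unions s) \<and>
        (I_env_preserves_convex_finite_unions s \<longleftrightarrow> I_env_eq_cl_IF_convex_hull s)) \<and>
     (\<forall>s :: complex \<Rightarrow> 'a \<Rightarrow> 'a. banach_space_over s \<longrightarrow>
        (I_env_is_topological_closure s \<longleftrightarrow> I_env_preserves_convex_finite_unions s) \<and>
        (I_env_preserves_convex_finite_unions s \<longleftrightarrow> I_env_eq_cl_IF_convex_hull s))"
  unfolding Let_def
  using topological_closure_imp_preserves_unions preserves_unions_imp_eq_cl_IF
    eq_cl_IF_imp_topological_closure
  by meson

end
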